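(* The spaces $H^2_1$ and $H^2_2$ satisfy $$H^2=H^2_1\oplus H^2_2\qquad\text{with}\qquad H^2_1\cong S^{(n-1,1)}\quad\text{and}\quad H^2_2\cong S^{(n-2,1,1)}$$ as representations of $\mathfrak S_n$.
   Context: Let $n\ge 3$, $[n]=\{1,\dots,n\}$. For distinct $a,b\in[n]$, $ab$ denotes the two-letter word, and $x_{a\succ b}=\delta_{ab}-\delta_{ba}$, a real function on the set of two-letter words with distinct letters in $[n]$ ($\delta$ denotes Dirac functions); so $x_{b\succ a}=-x_{a\succ b}$. For a pair $\{a,b\}$, $H_{\{a,b\}}=\mathbb R x_{a\succ b}$ (the space of functions on $\{ab,ba\}$ with zero sum), and $H^2=\bigoplus_{\{a,b\}\subset[n]}H_{\{a,b\}}$. The symmetric group $\mathfrak S_n$ acts linearly on $H^2$ by $T_\tau x_{a\succ b}=x_{\tau(a)\succ\tau(b)}$ (induced by $T_\tau\delta_{ab}=\delta_{\tau(a)\tau(b)}$). Set $$H^2_1=\operatorname{span}\Big\{e_a:=\sum_{b\in[n],\,b\ne a}x_{a\succ b}\ :\ a\in[n]\Big\},\qquad H^2_2=\operatorname{span}\Big\{f_{(a,b)}:=\sum_{c\in[n],\,c\notin\{a,b\}}(x_{a\succ b}+x_{b\succ c}+x_{c\succ a})\ :\ \{a,b\}\subset[n]\Big\}.$$ $S^\lambda$ denotes the Specht module (irreducible representation of $\mathfrak S_n$) indexed by the partition $\lambda$ of $n$. *)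

theory Defs
  imports
    "HOL-Analysis.Analysis"
    "HOL-Library.Function_Algebras"
    "HOL-Combinatorics.Permutations"
    "HOL-Algebra.Sym_Groups"
begin

section \<open>Real-valued functions as a real vector space\<close>

instantiation "fun" :: (type, real_vector) real_vector
begin

definition scaleR_fun :: "real \<Rightarrow> ('a \<Rightarrow> 'b) \<Rightarrow> 'a \<Rightarrow> 'b"
  where "scaleR_fun c f = (\<lambda>x. c *\<^sub>R f x)"

instance
  by standard (auto simp: scaleR_fun_def fun_eq_iff scaleR_add_left scaleR_add_right)

end

lemma scaleR_fun_apply [simp]: "(c *\<^sub>R f) x = c *\<^sub>R f x"
  by (simp add: scaleR_fun_def)

definition dirac :: "'a \<Rightarrow> 'a \<Rightarrow> real"
  where "dirac a = (\<lambda>b. if b = a then 1 else 0)"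

definition is_direct_sum :: "'v::real_vector set \<Rightarrow> 'v set \<Rightarrow> 'v set \<Rightarrow> bool"
  where "is_direct_sum V U W \<longleftrightarrow>
    subspace U \<and> subspace W \<and> V = {u + w | u w. u \<in> U \<and> w \<in> W} \<and> U \<inter> W = {0}"


section \<open>Linear representations on subspaces\<close>

text \<open>Only the values of \<^term>\<open>\<rho> g\<close> on \<^term>\<open>V\<close>, for \<^term>\<open>g\<close> in the carrier, matter.\<close>

definition linear_rep ::
    "('g, 'm) monoid_scheme \<Rightarrow> 'v::real_vector set \<Rightarrow> ('g \<Rightarrow> 'v \<Rightarrow> 'v) \<Rightarrow> bool"
  where "linear_rep G V \<rho> \<longleftrightarrow>
    group G \<and> subspace V \<and>
    (\<forall>g\<in>carrier G. \<forall>v\<in>V. \<rho> g v \<in> V) \<and>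
    (\<forall>g\<in>carrier G. \<forall>v\<in>V. \<forall>w\<in>V. \<rho> g (v + w) = \<rho> g v + \<rho> g w) \<and>
    (\<forall>g\<in>carrier G. \<forall>c. \<forall>v\<in>V. \<rho> g (c *\<^sub>R v) = c *\<^sub>R \<rho> g v) \<and>
    (\<forall>v\<in>V. \<rho> \<one>\<^bsub>G\<^esub> v = v) \<and>
    (\<forall>g\<in>carrier G. \<forall>h\<in>carrier G. \<forall>v\<in>V. \<rho> (g \<otimes>\<^bsub>G\<^esub> h) v = \<rho> g (\<rho> h v))"

definition rep_isomorphic ::
    "('g, 'm) monoid_scheme \<Rightarrow> 'v::real_vector set \<Rightarrow> ('g \<Rightarrow> 'v \<Rightarrow> 'v) \<Rightarrow>
     'w::real_vector set \<Rightarrow> ('g \<Rightarrow> 'w \<Rightarrow> 'w) \<Rightarrow> bool"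
  where "rep_isomorphic G V \<rho> W \<sigma> \<longleftrightarrow>
    linear_rep G V \<rho> \<and> linear_rep G W \<sigma> \<and>
    (\<exists>\<phi>. bij_betw \<phi> V W \<and>
      (\<forall>v\<in>V. \<forall>w\<in>V. \<phi> (v + w) = \<phi> v + \<phi> w) \<and>
      (\<forall>c. \<forall>v\<in>V. \<phi> (c *\<^sub>R v) = c *\<^sub>R \<phi> v) \<and>
      (\<forall>g\<in>carrier G. \<forall>v\<in>V. \<phi> (\<rho> g v) = \<sigma> g (\<phi> v)))"


section \<open>Specht modules\<close>

text \<open>
  Partitions are lists of row lengths. Cells of the Young diagram are pairs (row, column),
  both counted from 0; the entries of a tableau of a partition of \<open>n\<close> are \<open>1, \<dots>, n\<close>.
\<close>

definition young_diagram :: "nat list \<Rightarrow> (nat \<times> nat) set"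
  where "young_diagram l = {(i, j). i < length l \<and> j < l ! i}"

text \<open>
  Tableaux vanish outside the diagram, so that equal fillings are equal functions.
  A permutation of \<open>{1..n}\<close> fixes 0, hence this normalisation is preserved by composition.
\<close>

definition tableaux :: "nat list \<Rightarrow> (nat \<times> nat \<Rightarrow> nat) set"
  where "tableaux l = {t. bij_betw t (young_diagram l) {1..sum_list l} \<and>
    (\<forall>c. c \<notin> young_diagram l \<longrightarrow> t c = 0)}"

definition tab_row :: "nat list \<Rightarrow> (nat \<times> nat \<Rightarrow> nat) \<Rightarrow> nat \<Rightarrow> nat set"
  where "tab_row l t i = t ` {c \<in> young_diagram l. fst c = i}"

definition tab_column :: "nat list \<Rightarrow> (nat \<times> nat \<Rightarrow> nat) \<Rightarrow> nat \<Rightarrow> nat set"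
  where "tab_column l t j = t ` {c \<in> young_diagram l. snd c = j}"

definition tabloid :: "nat list \<Rightarrow> (nat \<times> nat \<Rightarrow> nat) \<Rightarrow> (nat \<times> nat \<Rightarrow> nat) set"
  where "tabloid l t = {s \<in> tableaux l. \<forall>i. tab_row l s i = tab_row l t i}"

definition column_stabilizer :: "nat list \<Rightarrow> (nat \<times> nat \<Rightarrow> nat) \<Rightarrow> (nat \<Rightarrow> nat) set"
  where "column_stabilizer l t =
    {\<pi> \<in> carrier (sym_group (sum_list l)). \<forall>j. \<pi> ` tab_column l t j = tab_column l t j}"

text \<open>
  The permutation module on tabloids is realised by real functions on sets of tableaux,
  the basis vector of a tabloid being its Dirac function.
\<close>

definition polytabloid ::
    "nat list \<Rightarrow> (nat \<times> nat \<Rightarrow> nat) \<Rightarrow> (nat \<times> nat \<Rightarrow> nat) set \<Rightarrow> real"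
  where "polytabloid l t =
    (\<Sum>\<pi>\<in>column_stabilizer l t. of_int (sign \<pi>) *\<^sub>R dirac (tabloid l (\<pi> \<circ> t)))"

definition specht :: "nat list \<Rightarrow> ((nat \<times> nat \<Rightarrow> nat) set \<Rightarrow> real) set"
  where "specht l = span (polytabloid l ` tableaux l)"

definition specht_action ::
    "(nat \<Rightarrow> nat) \<Rightarrow> ((nat \<times> nat \<Rightarrow> nat) set \<Rightarrow> real) \<Rightarrow> (nat \<times> nat \<Rightarrow> nat) set \<Rightarrow> real"
  where "specht_action \<tau> f = f \<circ> image ((\<circ>) (inv_into UNIV \<tau>))"

lemma dirac_comp_inv:
  assumes "bij g"
  shows "dirac a \<circ> inv_into UNIV g = dirac (g a)"
  using assms
  by (auto simp: dirac_def fun_eq_iff bij_is_inj bij_is_surj inv_f_f surj_f_inv_f)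

text \<open>The action sends the basis vector of \<open>S\<close> to that of the image of \<open>S\<close> under \<open>\<tau>\<close>.\<close>

lemma specht_action_dirac:
  assumes "bij \<tau>"
  shows "specht_action \<tau> (dirac S) = dirac ((\<lambda>t. \<tau> \<circ> t) ` S)"
proof -
  let ?g = "image ((\<circ>) \<tau>) :: (nat \<times> nat \<Rightarrow> nat) set \<Rightarrow> _"
  have 1: "\<tau> \<circ> inv_into UNIV \<tau> = id" "inv_into UNIV \<tau> \<circ> \<tau> = id"
    using assms by (auto simp: surj_iff[symmetric] inj_iff[symmetric] bij_def)
  have 2: "image ((\<circ>) (inv_into UNIV \<tau>)) (?g A) = A"
    "?g (image ((\<circ>) (inv_into UNIV \<tau>)) A) = A" for A
    by (simp_all add: image_image o_assoc 1)
  have "bij ?g"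
    by (rule o_bij[of "image ((\<circ>) (inv_into UNIV \<tau>))"]) (simp_all only: fun_eq_iff o_apply id_apply 2 simp_thms)
  moreover have "inv_into UNIV ?g = image ((\<circ>) (inv_into UNIV \<tau>))"
    by (rule inv_equality) (simp_all only: 2)
  ultimately show ?thesis
    unfolding specht_action_def using dirac_comp_inv by metis
qed


section \<open>The space \<open>H\<^sup>2\<close> and its two subspaces\<close>

text \<open>The two-letter word \<open>ab\<close> is the pair \<^term>\<open>(a, b)\<close>.\<close>

definition xpref :: "nat \<Rightarrow> nat \<Rightarrow> nat \<times> nat \<Rightarrow> real"
  where "xpref a b = dirac (a, b) - dirac (b, a)"

definition H_pair :: "nat \<Rightarrow> nat \<Rightarrow> (nat \<times> nat \<Rightarrow> real) set"
  where "H_pair a b = span {xpref a b}"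

text \<open>
  The lines \<^term>\<open>H_pair a b\<close> of distinct unordered pairs have disjoint supports, so their
  sum below is direct; both orders of a pair give the same line.
\<close>

definition H2 :: "nat \<Rightarrow> (nat \<times> nat \<Rightarrow> real) set"
  where "H2 n = span (\<Union>a\<in>{1..n}. \<Union>b\<in>{1..n} - {a}. H_pair a b)"

definition word_action :: "(nat \<Rightarrow> nat) \<Rightarrow> (nat \<times> nat \<Rightarrow> real) \<Rightarrow> nat \<times> nat \<Rightarrow> real"
  where "word_action \<tau> f = f \<circ> map_prod (inv_into UNIV \<tau>) (inv_into UNIV \<tau>)"

definition evec :: "nat \<Rightarrow> nat \<Rightarrow> nat \<times> nat \<Rightarrow> real"
  where "evec n a = (\<Sum>b\<in>{1..n} - {a}. xpref a b)"

definition fvec :: "nat \<Rightarrow> nat \<Rightarrow> nat \<Rightarrow> nat \<times> nat \<Rightarrow> real"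
  where "fvec n a b = (\<Sum>c\<in>{1..n} - {a, b}. xpref a b + xpref b c + xpref c a)"

definition H2_1 :: "nat \<Rightarrow> (nat \<times> nat \<Rightarrow> real) set"
  where "H2_1 n = span {evec n a | a. a \<in> {1..n}}"

definition H2_2 :: "nat \<Rightarrow> (nat \<times> nat \<Rightarrow> real) set"
  where "H2_2 n = span {fvec n a b | a b. a \<in> {1..n} \<and> b \<in> {1..n} \<and> a \<noteq> b}"

lemma xpref_swap: "xpref b a = - xpref a b"
  by (simp add: xpref_def)

text \<open>Hence the choice of order of a pair does not affect the span \<^term>\<open>H2_2 n\<close>.\<close>

lemma fvec_swap: "fvec n b a = - fvec n a b"
proof -
  have "fvec n b a = (\<Sum>c\<in>{1..n} - {a, b}. - (xpref a b + xpref b c + xpref c a))"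
    unfolding fvec_def by (rule sum.cong) (auto simp: xpref_def)
  then show ?thesis
    unfolding fvec_def by (simp only: sum_negf)
qed

lemma word_action_dirac:
  assumes "bij \<tau>"
  shows "word_action \<tau> (dirac (a, b)) = dirac (\<tau> a, \<tau> b)"
  using assms
  by (auto simp: word_action_def dirac_def fun_eq_iff bij_is_inj bij_is_surj inv_f_f surj_f_inv_f)

lemma word_action_xpref:
  assumes "bij \<tau>"
  shows "word_action \<tau> (xpref a b) = xpref (\<tau> a) (\<tau> b)"
proof -
  have "word_action \<tau> (f - g) = word_action \<tau> f - word_action \<tau> g" for f g
    by (simp add: word_action_def fun_eq_iff)
  then show ?thesis
    using assms by (simp add: xpref_def word_action_dirac)
qed

lemma linear_rep_H2: "linear_rep (sym_group n) (H2 n) word_action"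
proof -
  have add: "word_action g (v + w) = word_action g v + word_action g w"
    and scale: "word_action g (c *\<^sub>R v) = c *\<^sub>R word_action g v" for g v w c
    by (simp_all add: word_action_def fun_eq_iff)
  then have lin: "linear (word_action g)" for g
    by (intro linearI)
  have H2: "H2 n = span {xpref a b | a b. a \<in> {1..n} \<and> b \<in> {1..n} \<and> a \<noteq> b}" (is "_ = span ?X")
  proof -
    have "H_pair a b \<subseteq> span ?X" if "a \<in> {1..n}" "b \<in> {1..n}" "a \<noteq> b" for a b
      unfolding H_pair_def using that by (intro span_mono) auto
    then have "(\<Union>a\<in>{1..n}. \<Union>b\<in>{1..n} - {a}. H_pair a b) \<subseteq> span ?X"
      by blast
    moreover have "?X \<subseteq> (\<Union>a\<in>{1..n}. \<Union>b\<in>{1..n} - {a}. H_pair a b)"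
      unfolding H_pair_def by (blast intro: span_base)
    ultimately show ?thesis
      unfolding H2_def by (intro equalityI span_minimal span_mono subspace_span)
  qed
  have closed: "word_action g v \<in> H2 n" if g: "g permutes {1..n}" and v: "v \<in> H2 n" for g v
  proof -
    have "word_action g ` ?X \<subseteq> ?X"
    proof
      fix y assume "y \<in> word_action g ` ?X"
      then obtain a b where ab: "a \<in> {1..n}" "b \<in> {1..n}" "a \<noteq> b"
        and "y = word_action g (xpref a b)"
        by blast
      then have y: "y = xpref (g a) (g b)"
        by (simp only: word_action_xpref[OF permutes_bij[OF g]])
      have "g a \<in> {1..n}" "g b \<in> {1..n}" "g a \<noteq> g b"
        using ab by (simp_all only: permutes_in_image[OF g] inj_eq[OF permutes_inj[OF g]] not_False_eq_True)
      with y show "y \<in> ?X" by blast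
    qed
    then have "span (word_action g ` ?X) \<subseteq> span ?X"
      by (rule span_mono)
    then show ?thesis
      using v unfolding H2 linear_span_image[OF lin] by blast
  qed
  have "word_action id v = v" for v
    by (simp add: word_action_def inv_id[unfolded id_def] fun_eq_iff)
  moreover have "word_action (g \<circ> h) v = word_action g (word_action h v)"
    if "g permutes {1..n}" "h permutes {1..n}" for g h v
    using that by (simp add: word_action_def o_inv_distrib permutes_bij fun_eq_iff)
  moreover have "subspace (H2 n)"
    by (simp only: H2_def subspace_span)
  ultimately show ?thesis
    using add scale closed sym_group_is_group
    unfolding linear_rep_def by (simp add: sym_group_def)
qed

lemma H_pair_altdef:
  assumes "a \<noteq> b"
  shows "H_pair a b =
    {f. (\<forall>w. w \<notin> {(a, b), (b, a)} \<longrightarrow> f w = 0) \<and> f (a, b) + f (b, a) = 0}" (is "_ = ?R")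
proof
  show "H_pair a b \<subseteq> ?R"
    using assms by (auto simp: H_pair_def span_singleton xpref_def dirac_def)
  show "?R \<subseteq> H_pair a b"
  proof
    fix f assume "f \<in> ?R"
    then have "f = f (a, b) *\<^sub>R xpref a b"
      using assms by (auto simp: xpref_def dirac_def fun_eq_iff)
    then show "f \<in> H_pair a b"
      unfolding H_pair_def span_singleton by blast
  qed
qed

end

theory Submission
  imports Defs
begin

text \<open>
  Both partitions are hooks \<open>(n - k, 1\<^sup>k)\<close>, with \<open>k = 1\<close> and \<open>k = 2\<close>. A tabloid of hook shape
  is determined by the word of the \<open>k\<close> entries below the corner, since the first row consists of
  the remaining numbers. Only the first column has more than one cell, so the column stabilizer
  of a tableau is the full symmetric group on the entries of that column. Hence the Specht module
  is spanned by explicit alternating sums over the words of length \<open>k + 1\<close> without repetition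
  (\<open>specht_hook\<close>). Writing \<open>d\<^sub>w\<close> for the Dirac function of the tabloid with word \<open>w\<close>, the generators
  are \<open>d\<^sub>b - d\<^sub>a\<close> for \<open>k = 1\<close>, and for \<open>k = 2\<close> they are the images of the cycles
  \<open>x\<^sub>a\<^sub>b + x\<^sub>b\<^sub>c + x\<^sub>c\<^sub>a\<close> under \<open>\<delta>\<^sub>p\<^sub>q \<mapsto> d\<^sub>p\<^sub>q\<close>.

  The identity \<open>f\<^sub>a\<^sub>b = n x\<^sub>a\<^sub>b + e\<^sub>b - e\<^sub>a\<close> (\<open>fvec_eq\<close>) does most of the work on the other side. It gives
  \<open>H\<^sup>2 = H\<^sup>2\<^sub>1 + H\<^sup>2\<^sub>2\<close>, and, because the \<open>e\<close> terms cancel in \<open>f\<^sub>a\<^sub>b + f\<^sub>b\<^sub>c + f\<^sub>c\<^sub>a\<close>, it shows that \<open>H\<^sup>2\<^sub>2\<close> is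
  spanned by the cycles. The second isomorphism is then the restriction of \<open>\<delta>\<^sub>p\<^sub>q \<mapsto> d\<^sub>p\<^sub>q\<close>.

  The first isomorphism is the row sum map \<open>\<delta>\<^sub>p\<^sub>q \<mapsto> d\<^sub>p\<close>. It sends \<open>e\<^sub>a\<close> to \<open>n d\<^sub>a - \<Sum>\<^sub>b d\<^sub>b\<close>, so
  \<open>e\<^sub>b - e\<^sub>a\<close> goes to \<open>n\<close> times a generator of the Specht module, and because \<open>\<Sum>\<^sub>a e\<^sub>a = 0\<close> the map
  \<open>d\<^sub>a \<mapsto> e\<^sub>a\<close> inverts it on \<open>H\<^sup>2\<^sub>1\<close> up to the factor \<open>n\<close>. Row sums vanish on cycles, hence on \<open>H\<^sup>2\<^sub>2\<close>,
  and being injective on \<open>H\<^sup>2\<^sub>1\<close> they also show that \<open>H\<^sup>2\<^sub>1\<close> and \<open>H\<^sup>2\<^sub>2\<close> meet only in \<open>0\<close>.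
\<close>

section \<open>Tableaux and tabloids of hook shape\<close>

definition hook :: "nat \<Rightarrow> nat \<Rightarrow> nat list"
  where "hook n k = (n - k) # replicate k 1"

definition hook_column :: "nat \<Rightarrow> (nat \<times> nat \<Rightarrow> nat) \<Rightarrow> nat list"
  where "hook_column k t = map (\<lambda>i. t (i, 0)) [0..<Suc k]"

definition hook_leg :: "nat \<Rightarrow> (nat \<times> nat \<Rightarrow> nat) \<Rightarrow> nat list"
  where "hook_leg k t = tl (hook_column k t)"

definition hook_tabloid :: "nat \<Rightarrow> nat \<Rightarrow> nat list \<Rightarrow> (nat \<times> nat \<Rightarrow> nat) set"
  where "hook_tabloid n k w = {t \<in> tableaux (hook n k). hook_leg k t = w}"

definition hook_words :: "nat \<Rightarrow> nat \<Rightarrow> nat list set"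
  where "hook_words n k = {w. length w = k \<and> distinct w \<and> set w \<subseteq> {1..n}}"

lemma length_hook_column [simp]: "length (hook_column k t) = Suc k"
  by (simp add: hook_column_def)

lemma hook_column_nth: "i \<le> k \<Longrightarrow> hook_column k t ! i = t (i, 0)"
  unfolding hook_column_def by (subst nth_map) (auto simp del: upt_Suc)

lemma set_hook_column: "set (hook_column k t) = t ` ({..k} \<times> {0})"
  by (force simp: hook_column_def simp del: upt_Suc)

lemma hook_leg_eq: "hook_leg k t = map (\<lambda>i. t (i, 0)) [1..<Suc k]"
  by (simp add: hook_leg_def hook_column_def map_tl[symmetric] tl_upt del: upt_Suc)

lemma set_hook_leg: "set (hook_leg k t) = t ` ({1..k} \<times> {0})"
  by (force simp: hook_leg_eq simp del: upt_Suc)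

lemma hook_leg_eq_iff: "hook_leg k s = hook_leg k t \<longleftrightarrow> (\<forall>i\<in>{1..k}. s (i, 0) = t (i, 0))"
  by (auto simp: hook_leg_eq simp del: upt_Suc)

lemma hook_leg_comp: "hook_leg k (g \<circ> t) = map g (hook_leg k t)"
  by (simp add: hook_leg_eq)

lemma sum_list_hook: "k \<le> n \<Longrightarrow> sum_list (hook n k) = n"
  by (simp add: hook_def sum_list_replicate)

lemma young_diagram_hook:
  assumes "k < n"
  shows "young_diagram (hook n k) = {0} \<times> {..<n - k} \<union> {1..k} \<times> {0}"
  using assms by (force simp: young_diagram_def hook_def nth_Cons split: nat.splits)

lemma hook_tableauxD:
  assumes "t \<in> tableaux (hook n k)" "k < n"
  shows "inj_on t (young_diagram (hook n k))" "t ` young_diagram (hook n k) = {1..n}"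
  using assms by (auto simp: tableaux_def sum_list_hook bij_betw_def)

lemma tab_row_hook:
  assumes "k < n"
  shows "tab_row (hook n k) t i =
    (if i = 0 then t ` ({0} \<times> {..<n - k}) else if i \<le> k then {t (i, 0)} else {})"
proof -
  have "{c \<in> young_diagram (hook n k). fst c = i} =
    (if i = 0 then {0} \<times> {..<n - k} else if i \<le> k then {(i, 0)} else {})"
    using assms by (auto simp: young_diagram_hook)
  then show ?thesis
    by (simp add: tab_row_def)
qed

lemma tab_column_hook:
  assumes "k < n"
  shows "tab_column (hook n k) t j =
    (if j = 0 then set (hook_column k t) else if j < n - k then {t (0, j)} else {})"
proof -
  have "{c \<in> young_diagram (hook n k). snd c = j} =
    (if j = 0 then {..k} \<times> {0} else if j < n - k then {(0, j)} else {})"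
    using assms by (auto simp: young_diagram_hook)
  then show ?thesis
    by (simp add: tab_column_def set_hook_column)
qed

text \<open>
  The rows below the first are single cells, and the first row is the complement of their entries.
\<close>

lemma tabloid_hook:
  assumes t: "t \<in> tableaux (hook n k)" and "k < n"
  shows "tabloid (hook n k) t = hook_tabloid n k (hook_leg k t)"
proof -
  have row0: "tab_row (hook n k) s 0 = {1..n} - set (hook_leg k s)"
    if s: "s \<in> tableaux (hook n k)" for s
  proof -
    let ?D = "young_diagram (hook n k)"
    have "s ` (?D - {1..k} \<times> {0}) = s ` ?D - s ` ({1..k} \<times> {0})"
      using \<open>k < n\<close> by (intro inj_on_image_set_diff[OF hook_tableauxD(1)[OF s]]) (auto simp: young_diagram_hook)
    moreover have "?D - {1..k} \<times> {0} = {0} \<times> {..<n - k}"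
      using \<open>k < n\<close> by (auto simp: young_diagram_hook)
    ultimately show ?thesis
      using \<open>k < n\<close> by (simp add: tab_row_hook set_hook_leg hook_tableauxD(2)[OF s])
  qed
  have "(\<forall>i. tab_row (hook n k) s i = tab_row (hook n k) t i) \<longleftrightarrow> hook_leg k s = hook_leg k t"
    if s: "s \<in> tableaux (hook n k)" for s
  proof
    assume rows: "\<forall>i. tab_row (hook n k) s i = tab_row (hook n k) t i"
    have "s (i, 0) = t (i, 0)" if "i \<in> {1..k}" for i
      using rows[rule_format, of i] that \<open>k < n\<close> by (simp add: tab_row_hook)
    then show "hook_leg k s = hook_leg k t"
      by (simp add: hook_leg_eq_iff)
  next
    assume leg: "hook_leg k s = hook_leg k t"
    show "\<forall>i. tab_row (hook n k) s i = tab_row (hook n k) t i"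
    proof
      fix i
      show "tab_row (hook n k) s i = tab_row (hook n k) t i"
      proof (cases "i = 0")
        case True
        then show ?thesis using row0[OF s] row0[OF t] leg by simp
      next
        case False
        then show ?thesis using leg \<open>k < n\<close> by (simp add: tab_row_hook hook_leg_eq_iff)
      qed
    qed
  qed
  then show ?thesis
    unfolding tabloid_def hook_tabloid_def by blast
qed

lemma hook_column_in_hook_words:
  assumes t: "t \<in> tableaux (hook n k)" and "k < n"
  shows "hook_column k t \<in> hook_words n (Suc k)"
proof -
  have sub: "{..k} \<times> {0} \<subseteq> young_diagram (hook n k)"
    using \<open>k < n\<close> by (auto simp: young_diagram_hook)
  then have "set (hook_column k t) \<subseteq> {1..n}"
    using hook_tableauxD(2)[OF t \<open>k < n\<close>] unfolding set_hook_column by blast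
  moreover have "distinct (hook_column k t)"
    unfolding distinct_conv_nth
  proof (intro allI impI)
    fix i j assume "i < length (hook_column k t)" "j < length (hook_column k t)" "i \<noteq> j"
    moreover from this have "(i, 0) \<in> young_diagram (hook n k)" "(j, 0) \<in> young_diagram (hook n k)"
      using sub by auto
    ultimately show "hook_column k t ! i \<noteq> hook_column k t ! j"
      using inj_onD[OF hook_tableauxD(1)[OF t \<open>k < n\<close>], of "(i, 0)" "(j, 0)"]
      by (auto simp: hook_column_nth)
  qed
  ultimately show ?thesis
    by (simp add: hook_words_def)
qed

text \<open>
  Used to complete a prescribed first column to a tableau.
\<close>

lemma ex_bij_betw_extending:
  assumes "finite A" "finite B" "card A = card B"
    and "C \<subseteq> A" "inj_on f C" "f ` C \<subseteq> B"
  shows "\<exists>g. bij_betw g A B \<and> (\<forall>x\<in>C. g x = f x)"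
proof -
  have C: "finite C" "finite (f ` C)"
    using assms finite_subset by auto
  have "card (A - C) = card (B - f ` C)"
    using assms C by (simp add: card_Diff_subset card_image)
  then obtain h where h: "bij_betw h (A - C) (B - f ` C)"
    using assms finite_same_card_bij by (metis finite_Diff)
  let ?g = "\<lambda>x. if x \<in> C then f x else h x"
  have "bij_betw ?g C (f ` C)"
    using assms by (auto simp: bij_betw_def inj_on_def)
  moreover have "bij_betw ?g (A - C) (B - f ` C)"
    using h by (rule bij_betw_cong[THEN iffD1, rotated]) auto
  ultimately have "bij_betw ?g (C \<union> (A - C)) (f ` C \<union> (B - f ` C))"
    by (rule bij_betw_combine) auto
  moreover have "C \<union> (A - C) = A" "f ` C \<union> (B - f ` C) = B"
    using assms by auto
  ultimately show ?thesis
    by (metis (mono_tags, lifting))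
qed

lemma ex_hook_tableau:
  assumes w: "w \<in> hook_words n (Suc k)" and "k < n"
  shows "\<exists>t\<in>tableaux (hook n k). hook_column k t = w"
proof -
  let ?D = "young_diagram (hook n k)"
  have w': "length w = Suc k" "distinct w" "set w \<subseteq> {1..n}"
    using w by (auto simp: hook_words_def)
  have "card ?D = card ({0::nat} \<times> {..<n - k}) + card ({1..k} \<times> {0::nat})"
    unfolding young_diagram_hook[OF \<open>k < n\<close>] by (rule card_Un_disjoint) auto
  then have card: "card ?D = n"
    using \<open>k < n\<close> by (simp add: card_cartesian_product)
  have "\<exists>g. bij_betw g ?D {1..n} \<and> (\<forall>c\<in>{..k} \<times> {0}. g c = w ! fst c)"
  proof (rule ex_bij_betw_extending)
    show "finite ?D" using \<open>k < n\<close> by (simp add: young_diagram_hook)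
    show "card ?D = card {1..n}" using card by simp
    show "{..k} \<times> {0} \<subseteq> ?D" using \<open>k < n\<close> by (auto simp: young_diagram_hook)
    show "inj_on (\<lambda>c. w ! fst c) ({..k} \<times> {0::nat})"
      using w' by (auto simp: inj_on_def nth_eq_iff_index_eq)
    have "w ! i \<in> {1..n}" if "i \<le> k" for i
      using subsetD[OF w'(3) nth_mem[of i w]] w'(1) that by simp
    then show "(\<lambda>c. w ! fst c) ` ({..k} \<times> {0::nat}) \<subseteq> {1..n}"
      by auto
  qed simp
  then obtain g where g: "bij_betw g ?D {1..n}" "\<And>i. i \<le> k \<Longrightarrow> g (i, 0) = w ! i"
    by force
  let ?t = "\<lambda>c. if c \<in> ?D then g c else 0"
  have "bij_betw ?t ?D {1..n}"
    using g(1) by (rule bij_betw_cong[THEN iffD1, rotated]) auto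
  then have "?t \<in> tableaux (hook n k)"
    using \<open>k < n\<close> by (simp add: tableaux_def sum_list_hook)
  moreover have "hook_column k ?t = w"
  proof (rule nth_equalityI)
    fix i assume "i < length (hook_column k ?t)"
    moreover from this have "(i, 0) \<in> ?D"
      using \<open>k < n\<close> by (auto simp: young_diagram_hook)
    ultimately show "hook_column k ?t ! i = w ! i"
      by (simp add: hook_column_nth g(2))
  qed (simp add: w')
  ultimately show ?thesis by blast
qed

text \<open>
  The tabloid of \<open>w\<close> is not empty: as \<open>k < n\<close>, a number is left for the corner, and the column thus
  obtained extends to a tableau. Any of its tableaux determines the word.
\<close>

lemma hook_tabloid_inject:
  assumes w: "w \<in> hook_words n k" and "k < n" and eq: "hook_tabloid n k w = hook_tabloid n k v"
  shows "w = v"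
proof -
  have w': "length w = k" "distinct w" "set w \<subseteq> {1..n}"
    using w by (auto simp: hook_words_def)
  have "card (set w) < card {1..n}"
    using w' \<open>k < n\<close> by (simp add: distinct_card)
  then have "\<not> {1..n} \<subseteq> set w"
    by (meson List.finite_set card_mono not_le)
  then obtain x where "x \<in> {1..n}" "x \<notin> set w" by blast
  with w' have "x # w \<in> hook_words n (Suc k)"
    by (simp add: hook_words_def)
  then obtain t where "t \<in> tableaux (hook n k)" "hook_column k t = x # w"
    using ex_hook_tableau \<open>k < n\<close> by blast
  then have "t \<in> hook_tabloid n k w"
    by (simp add: hook_tabloid_def hook_leg_def)
  moreover from this eq have "t \<in> hook_tabloid n k v"
    by simp
  ultimately show ?thesis
    by (simp add: hook_tabloid_def)
qed

lemma permutes_comp_tableaux: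
  assumes g: "g permutes {1..sum_list l}" and t: "t \<in> tableaux l"
  shows "g \<circ> t \<in> tableaux l"
proof -
  have "bij_betw (g \<circ> t) (young_diagram l) {1..sum_list l}"
    using t permutes_imp_bij[OF g] by (auto simp: tableaux_def intro: bij_betw_trans)
  moreover have "g 0 = 0"
    using permutes_not_in[OF g] by simp
  ultimately show ?thesis
    using t by (simp add: tableaux_def)
qed

lemma image_hook_tabloid:
  assumes g: "g permutes {1..n}" and "k < n"
  shows "(\<lambda>t. g \<circ> t) ` hook_tabloid n k w = hook_tabloid n k (map g w)"
proof
  have sum: "sum_list (hook n k) = n"
    using \<open>k < n\<close> by (simp add: sum_list_hook)
  show "(\<lambda>t. g \<circ> t) ` hook_tabloid n k w \<subseteq> hook_tabloid n k (map g w)"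
    using permutes_comp_tableaux[of g "hook n k"] g sum
    by (auto simp: hook_tabloid_def hook_leg_comp)
  show "hook_tabloid n k (map g w) \<subseteq> (\<lambda>t. g \<circ> t) ` hook_tabloid n k w"
  proof
    fix s assume s: "s \<in> hook_tabloid n k (map g w)"
    have "inv_into UNIV g \<circ> s \<in> hook_tabloid n k w"
      using s permutes_comp_tableaux[of "inv_into UNIV g" "hook n k" s] permutes_inv[OF g] sum
      by (simp add: hook_tabloid_def hook_leg_comp permutes_inv_o[OF g])
    moreover have "s = g \<circ> (inv_into UNIV g \<circ> s)"
      by (simp add: o_assoc permutes_inv_o[OF g])
    ultimately show "s \<in> (\<lambda>t. g \<circ> t) ` hook_tabloid n k w"
      by blast
  qed
qed

text \<open>
  Every column but the first is a single cell, whose entry a column-preserving permutation must fix.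
\<close>

lemma column_stabilizer_hook:
  assumes t: "t \<in> tableaux (hook n k)" and "k < n"
  shows "column_stabilizer (hook n k) t = {\<pi>. \<pi> permutes set (hook_column k t)}"
proof -
  let ?C = "set (hook_column k t)"
  have sub: "?C \<subseteq> {1..n}"
    using hook_column_in_hook_words[OF assms] by (simp add: hook_words_def)
  have "\<pi> permutes {1..n} \<and> (\<forall>j. \<pi> ` tab_column (hook n k) t j = tab_column (hook n k) t j)
    \<longleftrightarrow> \<pi> permutes ?C" (is "?L \<longleftrightarrow> ?R") for \<pi>
  proof
    assume L: ?L
    show ?R
    proof (rule permutes_superset)
      show "\<pi> permutes {1..n}" using L by blast
      fix x assume x: "x \<in> {1..n} - ?C"
      then obtain c where "c \<in> young_diagram (hook n k)" "x = t c"
        using hook_tableauxD(2)[OF assms] by blast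
      moreover from this have "c \<notin> {..k} \<times> {0}"
        using x by (auto simp: set_hook_column)
      ultimately obtain j where "j \<noteq> 0" "j < n - k" "x = t (0, j)"
        using \<open>k < n\<close> by (auto simp: young_diagram_hook)
      then show "\<pi> x = x"
        using L[THEN conjunct2, rule_format, of j] \<open>k < n\<close> by (simp add: tab_column_hook)
    qed
  next
    assume R: ?R
    have "\<pi> ` tab_column (hook n k) t j = tab_column (hook n k) t j" for j
    proof -
      have "t (0, j) \<notin> ?C" if "j \<noteq> 0" "j < n - k"
      proof
        assume "t (0, j) \<in> ?C"
        then obtain i where "i \<le> k" "t (0, j) = t (i, 0)"
          by (auto simp: set_hook_column)
        moreover from this have "(0, j) \<in> young_diagram (hook n k)" "(i, 0) \<in> young_diagram (hook n k)"
          using that \<open>k < n\<close> by (auto simp: young_diagram_hook)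
        ultimately show False
          using inj_onD[OF hook_tableauxD(1)[OF assms]] that by blast
      qed
      then show ?thesis
        using permutes_image[OF R] permutes_not_in[OF R] \<open>k < n\<close>
        by (simp add: tab_column_hook)
    qed
    with permutes_subset[OF R sub] show ?L by blast
  qed
  then show ?thesis
    using \<open>k < n\<close> by (simp add: column_stabilizer_def sum_list_hook sym_group_def)
qed

section \<open>Specht modules of hook shape\<close>

definition hook_polytabloid ::
    "nat \<Rightarrow> nat \<Rightarrow> nat list \<Rightarrow> (nat \<times> nat \<Rightarrow> nat) set \<Rightarrow> real"
  where "hook_polytabloid n k w =
    (\<Sum>\<pi> | \<pi> permutes set w. of_int (sign \<pi>) *\<^sub>R dirac (hook_tabloid n k (map \<pi> (tl w))))"

lemma polytabloid_hook:
  assumes t: "t \<in> tableaux (hook n k)" and "k < n"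
  shows "polytabloid (hook n k) t = hook_polytabloid n k (hook_column k t)"
  unfolding polytabloid_def hook_polytabloid_def column_stabilizer_hook[OF assms]
proof (rule sum.cong)
  fix \<pi> assume "\<pi> \<in> {\<pi>. \<pi> permutes set (hook_column k t)}"
  moreover have "set (hook_column k t) \<subseteq> {1..n}"
    using hook_column_in_hook_words[OF assms] by (simp add: hook_words_def)
  ultimately have "\<pi> permutes {1..n}"
    using permutes_subset by blast
  then have "\<pi> \<circ> t \<in> tableaux (hook n k)"
    using permutes_comp_tableaux[of \<pi> "hook n k" t] assms by (simp add: sum_list_hook)
  then show "of_int (sign \<pi>) *\<^sub>R dirac (tabloid (hook n k) (\<pi> \<circ> t)) =
      of_int (sign \<pi>) *\<^sub>R dirac (hook_tabloid n k (map \<pi> (tl (hook_column k t))))"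
    using \<open>k < n\<close> by (simp add: tabloid_hook hook_leg_comp) (simp add: hook_leg_def)
qed simp

lemma specht_hook:
  assumes "k < n"
  shows "specht (hook n k) = span (hook_polytabloid n k ` hook_words n (Suc k))"
proof -
  have "polytabloid (hook n k) ` tableaux (hook n k) =
      hook_polytabloid n k ` hook_column k ` tableaux (hook n k)"
    using polytabloid_hook[OF _ assms] by (simp add: image_image)
  also have "hook_column k ` tableaux (hook n k) = hook_words n (Suc k)"
    using hook_column_in_hook_words[OF _ assms] ex_hook_tableau[OF _ assms] by blast
  finally show ?thesis
    by (simp add: specht_def)
qed

text \<open>
  For the two shapes of interest, the alternating sum is expanded over the symmetric group on two
  and on three letters. The word lists the column downwards from the corner \<open>a\<close>, and a tabloid
  forgets the corner; in the second case the even permutations leave \<open>bc\<close>, \<open>ca\<close>, \<open>ab\<close> below it.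
\<close>

lemma hook_polytabloid_1:
  assumes "a \<noteq> b"
  shows "hook_polytabloid n 1 [a, b] = dirac (hook_tabloid n 1 [b]) - dirac (hook_tabloid n 1 [a])"
proof -
  have "{\<pi>. \<pi> permutes {a, b}} = {id, Transposition.transpose a b}"
    by (auto simp: permutes_doubleton_iff)
  moreover have "id \<noteq> Transposition.transpose a b"
    using assms by (metis id_apply transpose_apply_first)
  ultimately show ?thesis
    using assms by (simp add: hook_polytabloid_def sign_swap_id)
qed

lemma hook_polytabloid_2:
  assumes "a \<noteq> b" "a \<noteq> c" "b \<noteq> c"
  shows "hook_polytabloid n 2 [a, b, c] =
      (dirac (hook_tabloid n 2 [a, b]) - dirac (hook_tabloid n 2 [b, a]))
    + (dirac (hook_tabloid n 2 [b, c]) - dirac (hook_tabloid n 2 [c, b]))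
    + (dirac (hook_tabloid n 2 [c, a]) - dirac (hook_tabloid n 2 [a, c]))"
proof -
  have sign: "sign (Transposition.transpose x y \<circ> Transposition.transpose u v) = sign (Transposition.transpose x y) * sign (Transposition.transpose u v)"
    for x y u v :: nat
    by (intro sign_compose permutation_swap_id)
  show ?thesis
    using assms
    by (simp add: hook_polytabloid_def sum_over_permutations_insert sign sign_swap_id Transposition.transpose_def)
qed


section \<open>Isomorphisms of representations\<close>

lemma linear_word_action: "linear (word_action g)"
  by (rule linearI) (simp_all add: word_action_def fun_eq_iff)

lemma linear_specht_action: "linear (specht_action g)"
  by (rule linearI) (simp_all add: specht_action_def fun_eq_iff)

lemma linear_rep_subspace:
  assumes "linear_rep G V \<rho>" "subspace U" "U \<subseteq> V"
    and "\<And>g v. g \<in> carrier G \<Longrightarrow> v \<in> U \<Longrightarrow> \<rho> g v \<in> U"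
  shows "linear_rep G U \<rho>"
  using assms unfolding linear_rep_def by (simp add: subset_iff)

text \<open>
  Only the source has to be known to be a representation: an equivariant linear injection carries
  all the laws over to its image.
\<close>

lemma rep_isomorphic_image:
  assumes V: "linear_rep G V \<rho>" and \<phi>: "linear \<phi>" "inj_on \<phi> V"
    and equiv: "\<And>g v. g \<in> carrier G \<Longrightarrow> v \<in> V \<Longrightarrow> \<phi> (\<rho> g v) = \<sigma> g (\<phi> v)"
  shows "rep_isomorphic G V \<rho> (\<phi> ` V) \<sigma>"
proof -
  have rep: "group G" "subspace V" and closed: "\<And>g v. g \<in> carrier G \<Longrightarrow> v \<in> V \<Longrightarrow> \<rho> g v \<in> V"
    and add: "\<And>g v w. g \<in> carrier G \<Longrightarrow> v \<in> V \<Longrightarrow> w \<in> V \<Longrightarrow> \<rho> g (v + w) = \<rho> g v + \<rho> g w"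
    and scale: "\<And>g c v. g \<in> carrier G \<Longrightarrow> v \<in> V \<Longrightarrow> \<rho> g (c *\<^sub>R v) = c *\<^sub>R \<rho> g v"
    and one: "\<And>v. v \<in> V \<Longrightarrow> \<rho> \<one>\<^bsub>G\<^esub> v = v"
    and mult: "\<And>g h v. g \<in> carrier G \<Longrightarrow> h \<in> carrier G \<Longrightarrow> v \<in> V \<Longrightarrow>
        \<rho> (g \<otimes>\<^bsub>G\<^esub> h) v = \<rho> g (\<rho> h v)"
    using V unfolding linear_rep_def by blast+
  have add_mem: "v + w \<in> V" if "v \<in> V" "w \<in> V" for v w
    using subspace_add[OF rep(2)] that by blast
  have scale_mem: "c *\<^sub>R v \<in> V" if "v \<in> V" for c v
    using subspace_scale[OF rep(2)] that by blast
  have one_closed: "\<one>\<^bsub>G\<^esub> \<in> carrier G"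
    and mult_closed: "\<And>g h. g \<in> carrier G \<Longrightarrow> h \<in> carrier G \<Longrightarrow> g \<otimes>\<^bsub>G\<^esub> h \<in> carrier G"
    using rep(1) by (auto intro: group.is_monoid monoid.one_closed monoid.m_closed)
  have "linear_rep G (\<phi> ` V) \<sigma>"
    unfolding linear_rep_def
  proof (intro conjI ballI allI)
    show "group G" by (rule rep)
    show "subspace (\<phi> ` V)" by (rule linear_subspace_image[OF \<phi>(1) rep(2)])
  next
    fix g v assume "g \<in> carrier G" "v \<in> \<phi> ` V"
    then show "\<sigma> g v \<in> \<phi> ` V"
      using closed by (auto simp: equiv[symmetric])
  next
    fix g v w assume g: "g \<in> carrier G" and "v \<in> \<phi> ` V" "w \<in> \<phi> ` V"
    then obtain x y where xy: "x \<in> V" "y \<in> V" "v = \<phi> x" "w = \<phi> y" by blast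
    have "\<sigma> g (v + w) = \<phi> (\<rho> g (x + y))"
      using xy g by (simp add: equiv add_mem linear_add[OF \<phi>(1)])
    also have "\<dots> = \<sigma> g v + \<sigma> g w"
      using xy g by (simp add: add linear_add[OF \<phi>(1)] equiv)
    finally show "\<sigma> g (v + w) = \<sigma> g v + \<sigma> g w" .
  next
    fix g c v assume g: "g \<in> carrier G" and "v \<in> \<phi> ` V"
    then obtain x where x: "x \<in> V" "v = \<phi> x" by blast
    have "\<sigma> g (c *\<^sub>R v) = \<phi> (\<rho> g (c *\<^sub>R x))"
      using x g by (simp add: equiv scale_mem linear_scale[OF \<phi>(1)])
    also have "\<dots> = c *\<^sub>R \<sigma> g v"
      using x g by (simp add: scale linear_scale[OF \<phi>(1)] equiv)
    finally show "\<sigma> g (c *\<^sub>R v) = c *\<^sub>R \<sigma> g v" .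
  next
    fix v assume "v \<in> \<phi> ` V"
    then show "\<sigma> \<one>\<^bsub>G\<^esub> v = v"
      using one one_closed by (auto simp: equiv[symmetric])
  next
    fix g h v assume "g \<in> carrier G" "h \<in> carrier G" "v \<in> \<phi> ` V"
    then show "\<sigma> (g \<otimes>\<^bsub>G\<^esub> h) v = \<sigma> g (\<sigma> h v)"
      using mult closed mult_closed by (auto simp: equiv[symmetric])
  qed
  moreover have "bij_betw \<phi> V (\<phi> ` V)"
    using \<phi>(2) by (rule inj_on_imp_bij_betw)
  ultimately show ?thesis
    unfolding rep_isomorphic_def
    using V equiv linear_add[OF \<phi>(1)] linear_scale[OF \<phi>(1)] by blast
qed

lemma inj_on_span_if_left_inverse:
  fixes \<phi> :: "'a::real_vector \<Rightarrow> 'b::real_vector"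
  assumes "linear \<phi>" "linear \<psi>" "c \<noteq> 0" and inv: "\<And>x. x \<in> X \<Longrightarrow> \<psi> (\<phi> x) = c *\<^sub>R x"
  shows "inj_on \<phi> (span X)"
proof -
  have "linear (\<psi> \<circ> \<phi>)" "linear (\<lambda>x. c *\<^sub>R x)"
    using assms by (auto intro: linear_compose linear_scaleR)
  then have "(\<psi> \<circ> \<phi>) x = c *\<^sub>R x" if "x \<in> span X" for x
    using linear_eq_on[OF _ _ that] inv by (metis comp_apply)
  then show ?thesis
    using \<open>c \<noteq> 0\<close> by (intro inj_onI) (metis comp_apply scaleR_cancel_left)
qed

section \<open>The space of pairwise comparisons\<close>

definition pairs :: "nat \<Rightarrow> (nat \<times> nat) set"
  where "pairs n = {(a, b). a \<in> {1..n} \<and> b \<in> {1..n} \<and> a \<noteq> b}"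

definition xcycle :: "nat \<Rightarrow> nat \<Rightarrow> nat \<Rightarrow> nat \<times> nat \<Rightarrow> real"
  where "xcycle a b c = xpref a b + xpref b c + xpref c a"

lemma finite_pairs [simp]: "finite (pairs n)"
  by (rule finite_subset[of _ "{1..n} \<times> {1..n}"]) (auto simp: pairs_def)

lemma xpref_same [simp]: "xpref a a = 0"
  by (simp add: xpref_def)

lemma H2_eq_span_xpref: "H2 n = span {xpref a b | a b. (a, b) \<in> pairs n}" (is "_ = span ?X")
proof
  have "H_pair a b \<subseteq> span ?X" if "a \<in> {1..n}" "b \<in> {1..n} - {a}" for a b
    unfolding H_pair_def using that by (intro span_mono) (auto simp: pairs_def)
  then have "(\<Union>a\<in>{1..n}. \<Union>b\<in>{1..n} - {a}. H_pair a b) \<subseteq> span ?X"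
    by blast
  then show "H2 n \<subseteq> span ?X"
    unfolding H2_def by (intro span_minimal subspace_span)
  have "?X \<subseteq> (\<Union>a\<in>{1..n}. \<Union>b\<in>{1..n} - {a}. H_pair a b)"
    unfolding H_pair_def pairs_def by (blast intro: span_base)
  then show "span ?X \<subseteq> H2 n"
    unfolding H2_def by (rule span_mono)
qed

lemma subspace_H2: "subspace (H2 n)" and subspace_H2_1: "subspace (H2_1 n)"
  and subspace_H2_2: "subspace (H2_2 n)"
  by (simp_all add: H2_def H2_1_def H2_2_def)

lemma xpref_in_H2: "a \<in> {1..n} \<Longrightarrow> b \<in> {1..n} \<Longrightarrow> xpref a b \<in> H2 n"
  by (cases "a = b")
    (auto simp: H2_eq_span_xpref pairs_def subspace_0 intro!: span_base span_0)

lemma evec_in_H2_1: "a \<in> {1..n} \<Longrightarrow> evec n a \<in> H2_1 n"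
  unfolding H2_1_def by (rule span_base) blast

lemma evec_eq: "a \<in> {1..n} \<Longrightarrow> evec n a = (\<Sum>b\<in>{1..n}. xpref a b)"
  unfolding evec_def by (rule sum.mono_neutral_left) auto

text \<open>
  Summing the antisymmetric \<open>x\<^sub>a\<^sub>b\<close> over all ordered pairs gives \<open>0\<close>.
\<close>

lemma sum_evec: "(\<Sum>a\<in>{1..n}. evec n a) = 0"
proof -
  let ?S = "\<Sum>a\<in>{1..n}. \<Sum>b\<in>{1..n}. xpref a b"
  have "?S = (\<Sum>b\<in>{1..n}. \<Sum>a\<in>{1..n}. xpref a b)"
    by (rule sum.swap)
  also have "\<dots> = (\<Sum>b\<in>{1..n}. \<Sum>a\<in>{1..n}. - xpref b a)"
    by (intro sum.cong refl xpref_swap)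
  also have "\<dots> = - ?S"
    by (simp add: sum_negf)
  finally have "2 *\<^sub>R ?S = 0"
    by (simp add: scaleR_2 eq_neg_iff_add_eq_0)
  then show ?thesis
    by (simp add: evec_eq)
qed

lemma fvec_eq_sum_xcycle: "fvec n a b = (\<Sum>c\<in>{1..n} - {a, b}. xcycle a b c)"
  by (simp add: fvec_def xcycle_def)

text \<open>
  The terms \<open>c = a\<close> and \<open>c = b\<close> of the defining sum would vanish, so it may be extended to all \<open>c\<close>;
  its three parts are then \<open>n\<close> equal terms, \<open>e\<^sub>b\<close>, and \<open>- e\<^sub>a\<close>.
\<close>

lemma fvec_eq:
  assumes "(a, b) \<in> pairs n"
  shows "fvec n a b = real n *\<^sub>R xpref a b + evec n b - evec n a"
proof -
  have ab: "a \<in> {1..n}" "b \<in> {1..n}" "a \<noteq> b"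
    using assms by (auto simp: pairs_def)
  have degenerate: "xcycle a b a = 0" "xcycle a b b = 0"
    by (simp_all add: xcycle_def xpref_swap[of b a])
  have "fvec n a b = (\<Sum>c\<in>{1..n}. xcycle a b c)"
    unfolding fvec_eq_sum_xcycle
    by (rule sum.mono_neutral_left) (use degenerate in auto)
  also have "\<dots> = real n *\<^sub>R xpref a b + (\<Sum>c\<in>{1..n}. xpref b c) + (\<Sum>c\<in>{1..n}. xpref c a)"
    by (simp add: xcycle_def sum.distrib sum_constant_scaleR del: sum_constant)
  also have "(\<Sum>c\<in>{1..n}. xpref c a) = - (\<Sum>c\<in>{1..n}. xpref a c)"
    by (simp add: sum_negf[symmetric] xpref_swap[of a])
  finally show ?thesis
    by (simp only: evec_eq ab diff_conv_add_uminus)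
qed

text \<open>
  Each \<open>f\<^sub>a\<^sub>b\<close> is by definition a sum of cycles. Conversely, \<open>f\<^sub>a\<^sub>b + f\<^sub>b\<^sub>c + f\<^sub>c\<^sub>a\<close> is \<open>n\<close> times a cycle, as the
  differences of \<open>e\<close> vectors telescope.
\<close>

lemma H2_2_eq_span_xcycle: "H2_2 n = span {xcycle a b c | a b c. [a, b, c] \<in> hook_words n 3}"
  (is "_ = span ?C")
proof
  have "fvec n a b \<in> span ?C" if "a \<in> {1..n}" "b \<in> {1..n}" "a \<noteq> b" for a b
    unfolding fvec_eq_sum_xcycle
    by (intro span_sum span_base) (use that in \<open>auto simp: hook_words_def\<close>)
  then show "H2_2 n \<subseteq> span ?C"
    unfolding H2_2_def by (intro span_minimal subspace_span) blast
  have "xcycle a b c \<in> H2_2 n" if "[a, b, c] \<in> hook_words n 3" for a b c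
  proof -
    have abc: "(a, b) \<in> pairs n" "(b, c) \<in> pairs n" "(c, a) \<in> pairs n"
      using that by (auto simp: hook_words_def pairs_def)
    then have "n > 0"
      by (auto simp: pairs_def)
    have "fvec n a b + fvec n b c + fvec n c a = real n *\<^sub>R xcycle a b c"
      using abc by (simp add: fvec_eq xcycle_def scaleR_add_right)
    then have "xcycle a b c = (1 / real n) *\<^sub>R (fvec n a b + fvec n b c + fvec n c a)"
      using \<open>n > 0\<close> by simp
    moreover have "fvec n a b \<in> H2_2 n" "fvec n b c \<in> H2_2 n" "fvec n c a \<in> H2_2 n"
      using abc unfolding H2_2_def pairs_def by (auto intro!: span_base)
    ultimately show ?thesis
      using subspace_H2_2 by (simp add: subspace_add subspace_scale)
  qed
  then show "span ?C \<subseteq> H2_2 n"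
    by (intro span_minimal subspace_H2_2) blast
qed

lemma H2_1_subset_H2: "H2_1 n \<subseteq> H2 n"
  unfolding H2_1_def
proof (rule span_minimal[OF _ subspace_H2])
  show "{evec n a |a. a \<in> {1..n}} \<subseteq> H2 n"
    using xpref_in_H2 by (auto simp: evec_def intro!: subspace_sum subspace_H2)
qed

lemma H2_2_subset_H2: "H2_2 n \<subseteq> H2 n"
  unfolding H2_2_eq_span_xcycle
proof (rule span_minimal[OF _ subspace_H2])
  show "{xcycle a b c |a b c. [a, b, c] \<in> hook_words n 3} \<subseteq> H2 n"
    using xpref_in_H2 by (auto simp: xcycle_def hook_words_def intro!: subspace_add subspace_H2)
qed

text \<open>
  Solve \<open>f\<^sub>a\<^sub>b = n x\<^sub>a\<^sub>b + e\<^sub>b - e\<^sub>a\<close> for \<open>x\<^sub>a\<^sub>b\<close>.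
\<close>

lemma H2_sum:
  assumes "n > 0"
  shows "H2 n = {u + w | u w. u \<in> H2_1 n \<and> w \<in> H2_2 n}" (is "_ = ?S")
proof
  have "xpref a b \<in> ?S" if ab: "(a, b) \<in> pairs n" for a b
  proof -
    have "real n *\<^sub>R xpref a b = (evec n a - evec n b) + fvec n a b"
      using ab by (simp add: fvec_eq)
    then have "(1 / real n) *\<^sub>R (real n *\<^sub>R xpref a b) =
        (1 / real n) *\<^sub>R (evec n a - evec n b) + (1 / real n) *\<^sub>R fvec n a b"
      by (simp only: scaleR_add_right)
    then have "xpref a b = (1 / real n) *\<^sub>R (evec n a - evec n b) + (1 / real n) *\<^sub>R fvec n a b"
      using \<open>n > 0\<close> by simp
    moreover have "evec n a \<in> H2_1 n" "evec n b \<in> H2_1 n" "fvec n a b \<in> H2_2 n"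
      using ab evec_in_H2_1 unfolding H2_2_def pairs_def by (auto intro!: span_base)
    ultimately show ?thesis
      using subspace_H2_1 subspace_H2_2 by (blast intro: subspace_diff subspace_scale)
  qed
  moreover have "subspace ?S"
    by (rule subspace_sums[OF subspace_H2_1 subspace_H2_2])
  ultimately show "H2 n \<subseteq> ?S"
    unfolding H2_eq_span_xpref by (intro span_minimal) blast+
  show "?S \<subseteq> H2 n"
    using H2_1_subset_H2 H2_2_subset_H2 subspace_add[OF subspace_H2] by blast
qed

lemma word_action_evec:
  assumes g: "g permutes {1..n}" and a: "a \<in> {1..n}"
  shows "word_action g (evec n a) = evec n (g a)"
proof -
  have "word_action g (evec n a) = (\<Sum>b\<in>{1..n}. xpref (g a) (g b))"
    using a by (simp add: evec_eq linear_sum[OF linear_word_action] word_action_xpref permutes_bij[OF g])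
  also have "\<dots> = (\<Sum>b\<in>{1..n}. xpref (g a) b)"
    using sum.permute[OF g, of "xpref (g a)"] by (simp add: comp_def)
  also have "\<dots> = evec n (g a)"
    using permutes_in_image[OF g] a by (simp add: evec_eq)
  finally show ?thesis .
qed

lemma word_action_xcycle:
  assumes "g permutes {1..n}"
  shows "word_action g (xcycle a b c) = xcycle (g a) (g b) (g c)"
  by (simp add: xcycle_def linear_add[OF linear_word_action] word_action_xpref permutes_bij[OF assms])

lemma word_action_in_span:
  assumes "\<And>x. x \<in> X \<Longrightarrow> word_action g x \<in> X" "v \<in> span X"
  shows "word_action g v \<in> span X"
proof -
  have "word_action g v \<in> span (word_action g ` X)"
    using assms(2) linear_span_image[OF linear_word_action] by blast
  also have "\<dots> \<subseteq> span X"
    using assms(1) by (intro span_mono) blast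
  finally show ?thesis .
qed

lemma carrier_sym_group: "g \<in> carrier (sym_group n) \<longleftrightarrow> g permutes {1..n}"
  by (simp add: sym_group_def)

lemma linear_rep_H2_1: "linear_rep (sym_group n) (H2_1 n) word_action"
proof (rule linear_rep_subspace[OF linear_rep_H2 subspace_H2_1 H2_1_subset_H2])
  fix g v assume g: "g \<in> carrier (sym_group n)" and v: "v \<in> H2_1 n"
  then have g: "g permutes {1..n}"
    by (simp add: carrier_sym_group)
  show "word_action g v \<in> H2_1 n"
    using v unfolding H2_1_def
  proof (rule word_action_in_span[rotated])
    fix x assume "x \<in> {evec n a |a. a \<in> {1..n}}"
    then obtain a where "x = evec n a" "a \<in> {1..n}" by blast
    then have "word_action g x = evec n (g a)" "g a \<in> {1..n}"
      using g permutes_in_image[OF g] by (simp_all only: word_action_evec)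
    then show "word_action g x \<in> {evec n a |a. a \<in> {1..n}}" by blast
  qed
qed

lemma linear_rep_H2_2: "linear_rep (sym_group n) (H2_2 n) word_action"
proof (rule linear_rep_subspace[OF linear_rep_H2 subspace_H2_2 H2_2_subset_H2])
  fix g v assume g: "g \<in> carrier (sym_group n)" and v: "v \<in> H2_2 n"
  then have g: "g permutes {1..n}"
    by (simp add: carrier_sym_group)
  let ?C = "{xcycle a b c | a b c. [a, b, c] \<in> hook_words n 3}"
  show "word_action g v \<in> H2_2 n"
    using v unfolding H2_2_eq_span_xcycle
  proof (rule word_action_in_span[rotated])
    fix x assume "x \<in> ?C"
    then obtain a b c where x: "x = xcycle a b c" and abc: "[a, b, c] \<in> hook_words n 3" by blast
    have "word_action g x = xcycle (g a) (g b) (g c)"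
      using g x by (simp only: word_action_xcycle)
    moreover have "[g a, g b, g c] \<in> hook_words n 3"
      using abc permutes_in_image[OF g] inj_eq[OF permutes_inj[OF g]]
      unfolding hook_words_def by auto
    ultimately show "word_action g x \<in> ?C" by blast
  qed
qed

section \<open>Equivariant maps into spaces of tabloids\<close>

text \<open>
  The linear extension of \<open>\<delta>\<^sub>p \<mapsto> d\<^bsub>h p\<^esub>\<close>. Both isomorphisms have this form, where \<open>h\<close> keeps one or
  both letters of the word \<open>p\<close>; the map is equivariant as soon as \<open>h\<close> commutes with renaming letters.
\<close>

definition to_tabloids ::
    "nat \<Rightarrow> nat \<Rightarrow> (nat \<times> nat \<Rightarrow> nat list) \<Rightarrow> (nat \<times> nat \<Rightarrow> real) \<Rightarrow> (nat \<times> nat \<Rightarrow> nat) set \<Rightarrow> real"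
  where "to_tabloids n k h v = (\<Sum>p\<in>pairs n. v p *\<^sub>R dirac (hook_tabloid n k (h p)))"

lemma linear_to_tabloids: "linear (to_tabloids n k h)"
  by (rule linearI)
    (simp_all add: to_tabloids_def scaleR_add_left sum.distrib scaleR_sum_right)

lemma to_tabloids_dirac:
  assumes "p \<in> pairs n"
  shows "to_tabloids n k h (dirac p) = dirac (hook_tabloid n k (h p))"
proof -
  have "to_tabloids n k h (dirac p) =
      (\<Sum>q\<in>pairs n. if q = p then dirac (hook_tabloid n k (h q)) else 0)"
    unfolding to_tabloids_def dirac_def[of p] by (intro sum.cong) auto
  then show ?thesis
    using assms by simp
qed

lemma to_tabloids_xpref:
  assumes "(a, b) \<in> pairs n"
  shows "to_tabloids n k h (xpref a b) =
    dirac (hook_tabloid n k (h (a, b))) - dirac (hook_tabloid n k (h (b, a)))"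
proof -
  have "(b, a) \<in> pairs n"
    using assms by (auto simp: pairs_def)
  then show ?thesis
    using assms by (simp add: xpref_def linear_diff[OF linear_to_tabloids] to_tabloids_dirac)
qed

lemma to_tabloids_word_action:
  assumes g: "g permutes {1..n}" and "k < n" and v: "v \<in> H2 n"
    and h: "\<And>p. h (map_prod g g p) = map g (h p)"
  shows "to_tabloids n k h (word_action g v) = specht_action g (to_tabloids n k h v)"
proof -
  have lin: "linear (to_tabloids n k h \<circ> word_action g)" "linear (specht_action g \<circ> to_tabloids n k h)"
    by (intro linear_compose linear_to_tabloids linear_word_action linear_specht_action)+
  have "(to_tabloids n k h \<circ> word_action g) v = (specht_action g \<circ> to_tabloids n k h) v"
  proof (rule linear_eq_on[OF lin v[unfolded H2_eq_span_xpref]])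
    fix x assume "x \<in> {xpref a b |a b. (a, b) \<in> pairs n}"
    then obtain a b where x: "x = xpref a b" and ab: "(a, b) \<in> pairs n" by blast
    then have gab: "(g a, g b) \<in> pairs n"
      using permutes_in_image[OF g] inj_eq[OF permutes_inj[OF g]] unfolding pairs_def by auto
    have "specht_action g (dirac (hook_tabloid n k (h p))) = dirac (hook_tabloid n k (h (map_prod g g p)))"
      for p
      by (simp only: specht_action_dirac[OF permutes_bij[OF g]] image_hook_tabloid[OF g \<open>k < n\<close>] h)
    then have "specht_action g (to_tabloids n k h x) = to_tabloids n k h (xpref (g a) (g b))"
      using x ab gab by (simp add: to_tabloids_xpref linear_diff[OF linear_specht_action])
    then show "(to_tabloids n k h \<circ> word_action g) x = (specht_action g \<circ> to_tabloids n k h) x"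
      by (simp add: x word_action_xpref[OF permutes_bij[OF g]])
  qed
  then show ?thesis by simp
qed

text \<open>
  The linear extension of \<open>d\<^sub>w \<mapsto> u\<^sub>w\<close>, which provides the left inverses showing injectivity.
\<close>

definition from_tabloids ::
    "nat \<Rightarrow> nat \<Rightarrow> (nat list \<Rightarrow> 'v::real_vector) \<Rightarrow> ((nat \<times> nat \<Rightarrow> nat) set \<Rightarrow> real) \<Rightarrow> 'v"
  where "from_tabloids n k u F = (\<Sum>w\<in>hook_words n k. F (hook_tabloid n k w) *\<^sub>R u w)"

lemma linear_from_tabloids: "linear (from_tabloids n k u)"
  by (rule linearI)
    (simp_all add: from_tabloids_def scaleR_add_left sum.distrib scaleR_sum_right)

lemma from_tabloids_dirac:
  assumes "w \<in> hook_words n k" "k < n"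
  shows "from_tabloids n k u (dirac (hook_tabloid n k w)) = u w"
proof -
  have "finite (hook_words n k)"
    by (rule finite_subset[OF _ finite_lists_length_eq[of "{1..n}" k]]) (auto simp: hook_words_def)
  moreover have "from_tabloids n k u (dirac (hook_tabloid n k w)) =
      (\<Sum>v\<in>hook_words n k. if v = w then u v else 0)"
    unfolding from_tabloids_def dirac_def
    using hook_tabloid_inject[OF _ \<open>k < n\<close>] by (intro sum.cong) auto
  ultimately show ?thesis
    using assms by simp
qed

section \<open>The first component\<close>

text \<open>
  The row sums \<open>\<Sum>\<^sub>b v(ab)\<close>, read as coefficients of the one-letter tabloids \<open>d\<^sub>a\<close>.
\<close>

definition scores :: "nat \<Rightarrow> (nat \<times> nat \<Rightarrow> real) \<Rightarrow> (nat \<times> nat \<Rightarrow> nat) set \<Rightarrow> real"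
  where "scores n = to_tabloids n 1 (\<lambda>p. [fst p])"

lemma linear_scores: "linear (scores n)"
  unfolding scores_def by (rule linear_to_tabloids)

lemma scores_xpref:
  assumes "a \<in> {1..n}" "b \<in> {1..n}"
  shows "scores n (xpref a b) = dirac (hook_tabloid n 1 [a]) - dirac (hook_tabloid n 1 [b])"
proof (cases "a = b")
  case True
  then show ?thesis by (simp add: linear_0[OF linear_scores])
next
  case False
  then show ?thesis using assms by (simp add: scores_def to_tabloids_xpref pairs_def)
qed

lemma scores_evec:
  assumes "a \<in> {1..n}"
  shows "scores n (evec n a) =
    real n *\<^sub>R dirac (hook_tabloid n 1 [a]) - (\<Sum>b\<in>{1..n}. dirac (hook_tabloid n 1 [b]))"
  using assms
  by (simp add: evec_eq linear_sum[OF linear_scores] scores_xpref sum_subtractf sum_constant_scaleR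
      del: sum_constant)

text \<open>
  In a cycle each of the three letters is preferred once and dispreferred once.
\<close>

lemma scores_H2_2:
  assumes "v \<in> H2_2 n"
  shows "scores n v = 0"
proof (rule linear_eq_0_on_span[OF linear_scores _ assms[unfolded H2_2_eq_span_xcycle]])
  fix x assume "x \<in> {xcycle a b c |a b c. [a, b, c] \<in> hook_words n 3}"
  then show "scores n x = 0"
    by (auto simp: xcycle_def hook_words_def linear_add[OF linear_scores] scores_xpref)
qed

text \<open>
  The map \<open>d\<^sub>a \<mapsto> e\<^sub>a\<close> sends \<open>n d\<^sub>a - \<Sum>\<^sub>b d\<^sub>b\<close>, the image of \<open>e\<^sub>a\<close>, back to \<open>n e\<^sub>a - \<Sum>\<^sub>b e\<^sub>b = n e\<^sub>a\<close>.
\<close>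

lemma inj_on_scores:
  assumes "1 < n"
  shows "inj_on (scores n) (H2_1 n)"
  unfolding H2_1_def
proof (rule inj_on_span_if_left_inverse[OF linear_scores linear_from_tabloids])
  show "real n \<noteq> 0" using assms by simp
  let ?\<psi> = "from_tabloids n 1 (\<lambda>w. evec n (hd w))"
  fix x assume "x \<in> {evec n a |a. a \<in> {1..n}}"
  then obtain a where x: "x = evec n a" and a: "a \<in> {1..n}" by blast
  have \<psi>: "?\<psi> (dirac (hook_tabloid n 1 [b])) = evec n b" if "b \<in> {1..n}" for b
    using that assms by (subst from_tabloids_dirac) (auto simp: hook_words_def)
  have "?\<psi> (scores n x) = real n *\<^sub>R evec n a - (\<Sum>b\<in>{1..n}. evec n b)"
    unfolding x scores_evec[OF a] linear_diff[OF linear_from_tabloids]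
      linear_scale[OF linear_from_tabloids] linear_sum[OF linear_from_tabloids]
    using a by (simp only: \<psi> cong: sum.cong)
  then show "?\<psi> (scores n x) = real n *\<^sub>R x"
    by (simp only: sum_evec x diff_zero)
qed

text \<open>
  The image of \<open>e\<^sub>a\<close> is the sum of all \<open>d\<^sub>a - d\<^sub>b\<close>, so it lies in the Specht module; conversely,
  \<open>e\<^sub>b - e\<^sub>a\<close> is sent to \<open>n\<close> times the polytabloid \<open>d\<^sub>b - d\<^sub>a\<close>.
\<close>

lemma scores_image:
  assumes "1 < n"
  shows "scores n ` H2_1 n = specht (hook n 1)"
proof -
  let ?d = "\<lambda>a. dirac (hook_tabloid n 1 [a])"
  let ?E = "{evec n a |a. a \<in> {1..n}}"
  let ?P = "hook_polytabloid n 1 ` hook_words n (Suc 1)"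
  have image: "scores n ` H2_1 n = span (scores n ` ?E)"
    unfolding H2_1_def by (rule linear_span_image[OF linear_scores, symmetric])
  have diff: "?d a - ?d b \<in> span ?P" if "a \<in> {1..n}" "b \<in> {1..n}" for a b
  proof (cases "a = b")
    case False
    then have "?d a - ?d b = hook_polytabloid n 1 [b, a]"
      using hook_polytabloid_1 by metis
    moreover have "[b, a] \<in> hook_words n (Suc 1)"
      using that False by (simp add: hook_words_def)
    ultimately show ?thesis
      by (simp only: span_base imageI)
  qed (simp add: span_0)
  have "scores n (evec n a) \<in> span ?P" if "a \<in> {1..n}" for a
    using that diff
    by (auto simp: evec_eq linear_sum[OF linear_scores] scores_xpref intro!: span_sum)
  then have "span (scores n ` ?E) \<subseteq> span ?P"
    by (intro span_minimal subspace_span) blast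
  moreover have "hook_polytabloid n 1 w \<in> span (scores n ` ?E)" if "w \<in> hook_words n (Suc 1)" for w
  proof -
    have "length w = Suc (Suc 0)"
      using that by (simp add: hook_words_def)
    then obtain a b where w: "w = [a, b]"
      by (auto simp: length_Suc_conv)
    with that have ab: "a \<in> {1..n}" "b \<in> {1..n}" "a \<noteq> b"
      by (auto simp: hook_words_def)
    have "scores n (evec n b) - scores n (evec n a) = real n *\<^sub>R (?d b - ?d a)"
      using ab by (simp add: scores_evec scaleR_diff_right)
    then have "?d b - ?d a = (1 / real n) *\<^sub>R (scores n (evec n b) - scores n (evec n a))"
      using assms by simp
    moreover have "scores n (evec n b) \<in> span (scores n ` ?E)" "scores n (evec n a) \<in> span (scores n ` ?E)"
      using ab by (auto intro!: span_base)
    ultimately have "?d b - ?d a \<in> span (scores n ` ?E)"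
      by (simp only: span_diff span_scale)
    then show ?thesis
      by (simp only: w hook_polytabloid_1[OF ab(3)])
  qed
  then have "span ?P \<subseteq> span (scores n ` ?E)"
    by (intro span_minimal subspace_span) blast
  ultimately show ?thesis
    using image assms by (simp add: specht_hook)
qed

lemma H2_1_isomorphic_specht:
  assumes "1 < n"
  shows "rep_isomorphic (sym_group n) (H2_1 n) word_action (specht (hook n 1)) specht_action"
  unfolding scores_image[OF assms, symmetric]
proof (rule rep_isomorphic_image[OF linear_rep_H2_1 linear_scores inj_on_scores[OF assms]])
  fix g v assume "g \<in> carrier (sym_group n)" "v \<in> H2_1 n"
  then show "scores n (word_action g v) = specht_action g (scores n v)"
    unfolding scores_def
    using assms H2_1_subset_H2 by (intro to_tabloids_word_action) (auto simp: carrier_sym_group)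
qed

lemma H2_direct_sum:
  assumes "1 < n"
  shows "is_direct_sum (H2 n) (H2_1 n) (H2_2 n)"
proof -
  have "v = 0" if "v \<in> H2_1 n" "v \<in> H2_2 n" for v
    using inj_onD[OF inj_on_scores[OF assms], of v 0] that scores_H2_2 linear_0[OF linear_scores]
      subspace_0[OF subspace_H2_1] by metis
  then have "H2_1 n \<inter> H2_2 n = {0}"
    using subspace_0[OF subspace_H2_1] subspace_0[OF subspace_H2_2] by blast
  then show ?thesis
    unfolding is_direct_sum_def using H2_sum subspace_H2_1 subspace_H2_2 assms by auto
qed

section \<open>The second component\<close>

definition leg_embedding :: "nat \<Rightarrow> (nat \<times> nat \<Rightarrow> real) \<Rightarrow> (nat \<times> nat \<Rightarrow> nat) set \<Rightarrow> real"
  where "leg_embedding n = to_tabloids n 2 (\<lambda>p. [fst p, snd p])"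

lemma linear_leg_embedding: "linear (leg_embedding n)"
  unfolding leg_embedding_def by (rule linear_to_tabloids)

lemma inj_on_leg_embedding:
  assumes "2 < n"
  shows "inj_on (leg_embedding n) (span (dirac ` pairs n))"
  unfolding leg_embedding_def
proof (rule inj_on_span_if_left_inverse[OF linear_to_tabloids linear_from_tabloids])
  show "(1::real) \<noteq> 0" by simp
  fix x assume "x \<in> dirac ` pairs n"
  then obtain p where x: "x = dirac p" and p: "p \<in> pairs n" by blast
  then have "[fst p, snd p] \<in> hook_words n 2"
    by (auto simp: pairs_def hook_words_def)
  then show "from_tabloids n 2 (\<lambda>w. dirac (w ! 0, w ! 1)) (to_tabloids n 2 (\<lambda>p. [fst p, snd p]) x) = 1 *\<^sub>R x"
    using p assms by (simp add: x to_tabloids_dirac from_tabloids_dirac)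
qed

lemma H2_subset_span_dirac: "H2 n \<subseteq> span (dirac ` pairs n)"
  unfolding H2_eq_span_xpref
proof (rule span_minimal[OF _ subspace_span])
  have "xpref a b \<in> span (dirac ` pairs n)" if "(a, b) \<in> pairs n" for a b
  proof -
    have "(b, a) \<in> pairs n"
      using that by (auto simp: pairs_def)
    then show ?thesis
      unfolding xpref_def using that by (intro span_diff span_base) auto
  qed
  then show "{xpref a b |a b. (a, b) \<in> pairs n} \<subseteq> span (dirac ` pairs n)"
    by blast
qed

lemma leg_embedding_xcycle:
  assumes "[a, b, c] \<in> hook_words n 3"
  shows "leg_embedding n (xcycle a b c) = hook_polytabloid n 2 [a, b, c]"
  using assms
  by (simp add: hook_words_def xcycle_def leg_embedding_def linear_add[OF linear_to_tabloids]
      to_tabloids_xpref pairs_def hook_polytabloid_2)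

text \<open>
  The map carries the cycles that span \<open>H\<^sup>2\<^sub>2\<close> exactly onto the polytabloids.
\<close>

lemma leg_embedding_image:
  assumes "2 < n"
  shows "leg_embedding n ` H2_2 n = specht (hook n 2)"
proof -
  let ?C = "{xcycle a b c | a b c. [a, b, c] \<in> hook_words n 3}"
  have "leg_embedding n ` ?C = hook_polytabloid n 2 ` hook_words n 3"
  proof (intro equalityI subsetI)
    fix y assume "y \<in> leg_embedding n ` ?C"
    then show "y \<in> hook_polytabloid n 2 ` hook_words n 3"
      using leg_embedding_xcycle by blast
  next
    fix y assume "y \<in> hook_polytabloid n 2 ` hook_words n 3"
    then obtain w where y: "y = hook_polytabloid n 2 w" and w: "w \<in> hook_words n 3" by blast
    then obtain a b c where "w = [a, b, c]"
      by (auto simp: hook_words_def numeral_3_eq_3 length_Suc_conv)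
    then have "y = leg_embedding n (xcycle a b c)" "xcycle a b c \<in> ?C"
      using y w leg_embedding_xcycle by auto
    then show "y \<in> leg_embedding n ` ?C"
      by (rule image_eqI)
  qed
  then show ?thesis
    using assms
    by (simp add: H2_2_eq_span_xcycle linear_span_image[OF linear_leg_embedding, symmetric] specht_hook)
qed

lemma H2_2_isomorphic_specht:
  assumes "2 < n"
  shows "rep_isomorphic (sym_group n) (H2_2 n) word_action (specht (hook n 2)) specht_action"
  unfolding leg_embedding_image[OF assms, symmetric]
proof (rule rep_isomorphic_image[OF linear_rep_H2_2 linear_leg_embedding])
  show "inj_on (leg_embedding n) (H2_2 n)"
    using inj_on_leg_embedding[OF assms] H2_2_subset_H2 H2_subset_span_dirac
    by (meson inj_on_subset)
  fix g v assume "g \<in> carrier (sym_group n)" "v \<in> H2_2 n"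
  then show "leg_embedding n (word_action g v) = specht_action g (leg_embedding n v)"
    unfolding leg_embedding_def
    using assms H2_2_subset_H2 by (intro to_tabloids_word_action) (auto simp: carrier_sym_group)
qed

theorem theorem41:
  fixes n :: nat
  assumes "n \<ge> 3"
  shows "is_direct_sum (H2 n) (H2_1 n) (H2_2 n) \<and>
    rep_isomorphic (sym_group n) (H2_1 n) word_action (specht [n - 1, 1]) specht_action \<and>
    rep_isomorphic (sym_group n) (H2_2 n) word_action (specht [n - 2, 1, 1]) specht_action"
proof -
  have "hook n 1 = [n - 1, 1]" "hook n 2 = [n - 2, 1, 1]"
    by (simp_all add: hook_def numeral_2_eq_2)
  then show ?thesis
    using assms H2_direct_sum[of n] H2_1_isomorphic_specht[of n] H2_2_isomorphic_specht[of n]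
    by simp
qed

end
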